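(* Let $P,Q$ be orthogonal projections in a Hilbert space $\mathcal{H}$. If $A=P-Q$ is diagonalizable with nonzero eigenvalues $\pm\lambda_n$ (where $0<|\lambda_n|<1$) and, possibly, $\pm1$, then $T=PQ$ is S-decomposable with singular values $(1-\lambda_n^2)^{1/2}$ and, possibly, $1$.
   Context: A bounded operator $T$ is called S-decomposable if it has a singular value (Schmidt) decomposition $T=\sum_n s_n\langle\,\cdot\,,\xi_n\rangle\psi_n$ (strong convergence), where $\{\xi_n\}$ and $\{\psi_n\}$ are orthonormal systems indexed by the same index set (possibly finite or empty; countable when $\mathcal{H}$ is separable) and $s_n>0$ for all $n$. The numbers $s_n$ are the singular values of $T$. A self-adjoint operator is diagonalizable if there is an orthonormal basis of the space consisting of its eigenvectors. *)

theory Defs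
  imports "HOL-Analysis.Analysis" "HOL-Library.Equipollence"
begin

text \<open>
  Complex inner product spaces, built on top of \<open>real_inner\<close> so that norm, topology and infinite
  sums are those of the library.  Since \<open>inner x y = Re (cinner x y)\<close>, the norm is the one induced
  by \<open>cinner\<close>, and \<open>cinner\<close> is positive definite.  \<open>cinner\<close> is linear in its first argument.
\<close>

class complex_inner = real_inner +
  fixes scaleC :: "complex \<Rightarrow> 'a \<Rightarrow> 'a" (infixr "*\<^sub>C" 75)
    and cinner :: "'a \<Rightarrow> 'a \<Rightarrow> complex"
  assumes scaleC_add_right: "c *\<^sub>C (x + y) = c *\<^sub>C x + c *\<^sub>C y"
    and scaleC_add_left: "(c + d) *\<^sub>C x = c *\<^sub>C x + d *\<^sub>C x"
    and scaleC_scaleC: "c *\<^sub>C d *\<^sub>C x = (c * d) *\<^sub>C x"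
    and scaleC_of_real: "complex_of_real r *\<^sub>C x = r *\<^sub>R x"
    and cinner_commute: "cinner x y = cnj (cinner y x)"
    and cinner_add_left: "cinner (x + y) z = cinner x z + cinner y z"
    and cinner_scaleC_left: "cinner (c *\<^sub>C x) y = c * cinner x y"
    and inner_eq_Re_cinner: "inner x y = Re (cinner x y)"

class complex_hilbert = complex_inner + complete_space

instantiation complex :: complex_hilbert
begin

definition scaleC_complex :: "complex \<Rightarrow> complex \<Rightarrow> complex"
  where "scaleC_complex c x = c * x"

definition cinner_complex :: "complex \<Rightarrow> complex \<Rightarrow> complex"
  where "cinner_complex x y = x * cnj y"

instance
  by intro_classes
    (simp_all add: scaleC_complex_def cinner_complex_def algebra_simps inner_complex_def
      scaleR_conv_of_real)

end

interpretation complex_vector: vector_space "scaleC :: complex \<Rightarrow> 'a \<Rightarrow> 'a::complex_inner"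
  by unfold_locales
    (use scaleC_of_real[of 1] in
      \<open>simp_all add: scaleC_add_right scaleC_add_left scaleC_scaleC\<close>)

definition bounded_clinear :: "('a::complex_inner \<Rightarrow> 'a) \<Rightarrow> bool"
  where "bounded_clinear T \<longleftrightarrow> bounded_linear T \<and> (\<forall>c x. T (c *\<^sub>C x) = c *\<^sub>C T x)"

definition self_adjoint :: "('a::complex_inner \<Rightarrow> 'a) \<Rightarrow> bool"
  where "self_adjoint A \<longleftrightarrow> bounded_clinear A \<and> (\<forall>x y. cinner (A x) y = cinner x (A y))"

definition orthogonal_projection :: "('a::complex_inner \<Rightarrow> 'a) \<Rightarrow> bool"
  where "orthogonal_projection P \<longleftrightarrow> self_adjoint P \<and> P \<circ> P = P"

definition eigenspace :: "('a::complex_inner \<Rightarrow> 'a) \<Rightarrow> complex \<Rightarrow> 'a set"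
  where "eigenspace A \<mu> = {x. A x = \<mu> *\<^sub>C x}"

definition eigenvector :: "('a::complex_inner \<Rightarrow> 'a) \<Rightarrow> complex \<Rightarrow> 'a \<Rightarrow> bool"
  where "eigenvector A \<mu> x \<longleftrightarrow> x \<noteq> 0 \<and> x \<in> eigenspace A \<mu>"

definition eigenvalue :: "('a::complex_inner \<Rightarrow> 'a) \<Rightarrow> complex \<Rightarrow> bool"
  where "eigenvalue A \<mu> \<longleftrightarrow> (\<exists>x. eigenvector A \<mu> x)"

definition orthonormal_on :: "'i set \<Rightarrow> ('i \<Rightarrow> 'a::complex_inner) \<Rightarrow> bool"
  where "orthonormal_on J \<xi> \<longleftrightarrow>
    (\<forall>i\<in>J. \<forall>j\<in>J. cinner (\<xi> i) (\<xi> j) = (if i = j then 1 else 0))"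

definition orthonormal_basis :: "'a::complex_inner set \<Rightarrow> 'a set \<Rightarrow> bool"
  where "orthonormal_basis B S \<longleftrightarrow>
    orthonormal_on B (\<lambda>b. b) \<and> closure (complex_vector.span B) = S"

definition diagonalizable :: "('a::complex_inner \<Rightarrow> 'a) \<Rightarrow> bool"
  where "diagonalizable A \<longleftrightarrow> self_adjoint A \<and>
    (\<exists>B. orthonormal_basis B UNIV \<and> (\<forall>b\<in>B. \<exists>\<mu>. eigenvector A \<mu> b))"

text \<open>
  \<open>(s\<^sub>j)\<close>, \<open>j \<in> J\<close>, are the singular values of \<open>T\<close>, repeated according to multiplicity.
  The index set is arbitrary, so the strongly convergent series is an unordered sum.
\<close>

definition singular_value_decomposition ::
    "('a::complex_inner \<Rightarrow> 'a) \<Rightarrow> 'i set \<Rightarrow> ('i \<Rightarrow> real) \<Rightarrow> ('i \<Rightarrow> 'a) \<Rightarrow> ('i \<Rightarrow> 'a) \<Rightarrow> bool"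
  where "singular_value_decomposition T J s \<xi> \<psi> \<longleftrightarrow>
    orthonormal_on J \<xi> \<and> orthonormal_on J \<psi> \<and> (\<forall>j\<in>J. s j > 0) \<and>
    (\<forall>x. ((\<lambda>j. (complex_of_real (s j) * cinner x (\<xi> j)) *\<^sub>C \<psi> j) has_sum T x) J)"

definition S_decomposable_with ::
    "('a::complex_inner \<Rightarrow> 'a) \<Rightarrow> 'i set \<Rightarrow> ('i \<Rightarrow> real) \<Rightarrow> bool"
  where "S_decomposable_with T J s \<longleftrightarrow>
    bounded_clinear T \<and> (\<exists>\<xi> \<psi>. singular_value_decomposition T J s \<xi> \<psi>)"

end

theory Submission imports Defs begin

text \<open>
  Since \<open>T\<^sup>* T = Q P Q\<close>, the right singular vectors of \<open>T = P Q\<close> lie in the eigenspaces \<open>M r\<close>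
  of \<open>Q P Q\<close> inside the range of \<open>Q\<close>.  If \<open>A b = \<mu> b\<close> then \<open>Q b \<in> M (1 - \<mu>\<^sup>2)\<close>; as the
  eigenvectors of \<open>A\<close> are total, a maximal orthonormal set \<open>J\<close> in the union of the \<open>M r\<close>, \<open>r \<noteq> 0\<close>,
  is therefore large enough that \<open>P\<close> vanishes on the vectors of the range of \<open>Q\<close> orthogonal to
  \<open>J\<close>.  So \<open>J\<close> is a complete system of singular vectors, the singular value of \<open>j\<close> being
  \<open>\<parallel>P j\<parallel> = \<surd>r\<close>.  Up to a positive factor, \<open>A + \<lambda>\<close> maps \<open>M (1 - \<lambda>\<^sup>2)\<close> isometrically onto the
  eigenspace of \<open>A\<close> for \<open>\<lambda>\<close>, whence the multiplicities.
\<close>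

section \<open>Complex inner products\<close>

lemma cinner_add_right: "cinner x (y + z) = cinner x y + cinner x z"
  by (metis cinner_add_left cinner_commute complex_cnj_add)

lemma cinner_scaleC_right: "cinner x (c *\<^sub>C y) = cnj c * cinner x y"
  by (metis cinner_scaleC_left cinner_commute complex_cnj_mult)

lemma cinner_diff_left: "cinner (x - y) z = cinner x z - cinner y z"
  using cinner_add_left[of "x - y" y z] by simp

lemma cinner_diff_right: "cinner x (y - z) = cinner x y - cinner x z"
  using cinner_add_right[of x "y - z" z] by simp

lemma cinner_zero_left [simp]: "cinner 0 x = 0"
  using cinner_diff_left[of 0 0 x] by simp

lemma cinner_zero_right [simp]: "cinner x 0 = 0"
  using cinner_diff_right[of x 0 0] by simp

lemma cinner_sum_left: "cinner (sum f F) x = (\<Sum>j\<in>F. cinner (f j) x)"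
  by (induction F rule: infinite_finite_induct) (auto simp: cinner_add_left)

lemma cinner_sum_right: "cinner x (sum f F) = (\<Sum>j\<in>F. cinner x (f j))"
  by (induction F rule: infinite_finite_induct) (auto simp: cinner_add_right)

lemma cinner_self: "cinner x x = complex_of_real ((norm x)\<^sup>2)"
proof (rule complex_eqI)
  show "Re (cinner x x) = Re (complex_of_real ((norm x)\<^sup>2))"
    by (simp add: inner_eq_Re_cinner[symmetric] power2_norm_eq_inner)
  show "Im (cinner x x) = Im (complex_of_real ((norm x)\<^sup>2))"
    using cinner_commute[of x x] by (simp add: complex_eq_iff)
qed

lemma cinner_self_eq_0_iff [simp]: "cinner x x = 0 \<longleftrightarrow> x = 0"
  by (simp add: cinner_self)

lemma norm_scaleC: "norm (c *\<^sub>C x) = cmod c * norm (x::'a::complex_inner)"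
proof -
  have "complex_of_real ((norm (c *\<^sub>C x))\<^sup>2) = c * cnj c * complex_of_real ((norm x)\<^sup>2)"
    unfolding cinner_self[symmetric] by (simp add: cinner_scaleC_left cinner_scaleC_right)
  also have "\<dots> = complex_of_real ((cmod c * norm x)\<^sup>2)"
    by (simp add: complex_norm_square[symmetric] power_mult_distrib del: mult_cancel_right)
  finally have "(norm (c *\<^sub>C x))\<^sup>2 = (cmod c * norm x)\<^sup>2"
    using of_real_eq_iff by blast
  then show ?thesis by simp
qed

text \<open>The library's inequality bounds only the real part of \<open>cinner\<close>. Multiplying
  \<open>x\<close> by the conjugate phase \<open>c\<close> makes the product real and equal to its
  modulus. If the product is 0 then \<open>c\<close> is 0 too, so only \<open>cmod c\<close> at most
  1 is used.\<close>

lemma cmod_cinner_le: "cmod (cinner x y) \<le> norm x * norm y"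
proof -
  define c where "c = cnj (sgn (cinner x y))"
  have "c * cinner x y = complex_of_real (cmod (cinner x y))"
    using complex_norm_square[of "cinner x y"]
    by (cases "cinner x y = 0") (simp_all add: c_def sgn_eq field_simps power2_eq_square)
  then have "cmod (cinner x y) = inner (c *\<^sub>C x) y"
    by (simp add: inner_eq_Re_cinner cinner_scaleC_left)
  also have "\<dots> \<le> norm (c *\<^sub>C x) * norm y"
    by (rule norm_cauchy_schwarz)
  also have "\<dots> \<le> norm x * norm y"
    by (auto simp: norm_scaleC c_def norm_sgn)
  finally show ?thesis .
qed

lemma bounded_linear_cinner_left: "bounded_linear (\<lambda>x. cinner x y)"
proof (rule bounded_linear_intro[where K = "norm y"])
  show "cinner (r *\<^sub>R x) y = r *\<^sub>R cinner x y" for r x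
    by (metis cinner_scaleC_left scaleC_of_real scaleR_conv_of_real)
qed (auto simp: cinner_add_left cmod_cinner_le)

lemma bounded_linear_scaleC_right: "bounded_linear ((*\<^sub>C) c :: 'a::complex_inner \<Rightarrow> 'a)"
proof (rule bounded_linear_intro[where K = "cmod c"])
  show "c *\<^sub>C (r *\<^sub>R x) = r *\<^sub>R c *\<^sub>C x" for r and x :: 'a
    by (metis mult.commute scaleC_of_real scaleC_scaleC)
qed (auto simp: scaleC_add_right norm_scaleC)

lemma norm_eq_1_iff_cinner: "cinner x x = 1 \<longleftrightarrow> norm x = 1"
proof -
  have "cinner x x = 1 \<longleftrightarrow> (norm x)\<^sup>2 = 1"
    by (metis cinner_self of_real_1 of_real_eq_iff)
  then show ?thesis by (simp add: abs_square_eq_1)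
qed

text \<open>The vectors orthogonal to \<open>y\<close> form a closed subspace; once it contains
  \<open>B\<close> it is the whole space and contains \<open>y\<close> itself.\<close>

lemma eq_0_if_orthogonal_to_dense_span:
  assumes "closure (complex_vector.span B) = UNIV" and "\<And>b. b \<in> B \<Longrightarrow> cinner b y = 0"
  shows "y = 0"
proof -
  have "complex_vector.span B \<subseteq> {x. cinner x y = 0}"
    by (rule complex_vector.span_minimal)
      (auto simp: assms(2) complex_vector.subspace_def cinner_add_left cinner_scaleC_left)
  moreover have "closed {x. cinner x y = 0}"
    by (intro closed_Collect_eq continuous_intros
        bounded_linear.continuous_on[OF bounded_linear_cinner_left])
  ultimately have "UNIV \<subseteq> {x. cinner x y = 0}"
    using closure_minimal assms(1) by metis
  then have "cinner y y = 0" by blast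
  then show ?thesis by simp
qed

section \<open>Orthonormal expansions\<close>

lemma has_sum_mem_closed:
  assumes "closed M" and "(f has_sum x) S" and "\<And>F. finite F \<Longrightarrow> F \<subseteq> S \<Longrightarrow> sum f F \<in> M"
  shows "x \<in> M"
  using assms(2) unfolding has_sum_def
  by (rule Lim_in_closed_set[OF assms(1), rotated 2])
    (auto intro!: eventually_finite_subsets_at_top_weakI assms(3))

lemma norm_sum_orthonormal:
  assumes "orthonormal_on S (\<lambda>j. j)" and "finite F" "F \<subseteq> S"
  shows "(norm (\<Sum>j\<in>F. c j *\<^sub>C j))\<^sup>2 = (\<Sum>j\<in>F. (cmod (c j))\<^sup>2)"
proof -
  have "complex_of_real ((norm (\<Sum>j\<in>F. c j *\<^sub>C j))\<^sup>2)
      = (\<Sum>k\<in>F. \<Sum>j\<in>F. c j * cnj (c k) * cinner j k)"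
    unfolding cinner_self[symmetric] cinner_sum_left cinner_sum_right
    by (simp add: cinner_scaleC_left cinner_scaleC_right mult_ac)
  also have "\<dots> = (\<Sum>k\<in>F. \<Sum>j\<in>F. if j = k then c j * cnj (c k) else 0)"
    using assms by (intro sum.cong refl) (auto simp: orthonormal_on_def subset_eq)
  also have "\<dots> = (\<Sum>j\<in>F. complex_of_real ((cmod (c j))\<^sup>2))"
    unfolding complex_norm_square using assms(2) by simp
  also have "\<dots> = complex_of_real (\<Sum>j\<in>F. (cmod (c j))\<^sup>2)"
    by simp
  finally show ?thesis
    using of_real_eq_iff by blast
qed

text \<open>For the partial expansion \<open>y\<close>, both \<open>cinner x y\<close> and the
  squared norm of \<open>y\<close> equal the left-hand sum, so the claim is nonnegativity of the
  squared norm of \<open>x - y\<close>.\<close>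

lemma Bessel_inequality:
  assumes "orthonormal_on S (\<lambda>j. j)" and "finite F" "F \<subseteq> S"
  shows "(\<Sum>j\<in>F. (cmod (cinner x j))\<^sup>2) \<le> (norm x)\<^sup>2"
proof -
  define y where "y = (\<Sum>j\<in>F. cinner x j *\<^sub>C j)"
  have "cinner x y = complex_of_real (\<Sum>j\<in>F. (cmod (cinner x j))\<^sup>2)"
    by (simp add: y_def cinner_sum_right cinner_scaleC_right complex_norm_square mult.commute
        del: of_real_power)
  moreover have "(norm y)\<^sup>2 = (\<Sum>j\<in>F. (cmod (cinner x j))\<^sup>2)"
    unfolding y_def by (rule norm_sum_orthonormal[OF assms])
  moreover have "0 \<le> (norm (x - y))\<^sup>2" by simp
  then have "0 \<le> (norm x)\<^sup>2 - 2 * Re (cinner x y) + (norm y)\<^sup>2"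
    by (simp add: power2_norm_eq_inner inner_diff inner_commute inner_eq_Re_cinner[symmetric])
  ultimately show ?thesis by simp
qed

text \<open>By orthogonality, the squared distance between nested partial sums is the difference of
  their coefficient sums \<open>a\<close>. As these are bounded, the net of partial sums is Cauchy,
  and completeness gives the limit.\<close>

lemma orthonormal_summable:
  fixes S :: "'a::complex_hilbert set"
  assumes S: "orthonormal_on S (\<lambda>j. j)"
    and bd: "\<And>F. finite F \<Longrightarrow> F \<subseteq> S \<Longrightarrow> (\<Sum>j\<in>F. (cmod (c j))\<^sup>2) \<le> K"
  shows "(\<lambda>j. c j *\<^sub>C j) summable_on S"
proof -
  define a where "a F = (\<Sum>j\<in>F. (cmod (c j))\<^sup>2)" for F
  define FF where "FF = {F. finite F \<and> F \<subseteq> S}"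
  define f where "f j = c j *\<^sub>C j" for j :: 'a
  have bdd: "bdd_above (a ` FF)"
    using bd by (auto simp: bdd_above_def FF_def a_def)
  have "\<exists>R. eventually R (finite_subsets_at_top S) \<and>
             (\<forall>F F'. R F \<and> R F' \<longrightarrow> dist (sum f F) (sum f F') < e)" if "e > 0" for e
  proof -
    have "a ` FF \<noteq> {}" by (auto simp: FF_def)
    moreover have "Sup (a ` FF) - (e/2)\<^sup>2 < Sup (a ` FF)"
      using that by simp
    \<comment> \<open>\<open>F0\<close> nearly attains the supremum, so enlarging it adds less than
      \<open>(e/2)\<^sup>2\<close> to \<open>a\<close>.\<close>
    ultimately obtain F0 where F0: "F0 \<in> FF" "Sup (a ` FF) - (e/2)\<^sup>2 < a F0"
      using less_cSup_iff[OF _ bdd] by blast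
    define R where "R F \<longleftrightarrow> finite F \<and> F0 \<subseteq> F \<and> F \<subseteq> S" for F
    have near: "dist (sum f F) (sum f F0) < e/2" if "R F" for F
    proof -
      have fin: "finite F" "F0 \<subseteq> F" "F \<subseteq> S" using that by (auto simp: R_def)
      then have "(dist (sum f F) (sum f F0))\<^sup>2 = (norm (sum f (F - F0)))\<^sup>2"
        by (simp add: dist_norm sum_diff)
      also have "\<dots> = a (F - F0)"
        unfolding f_def a_def by (rule norm_sum_orthonormal[OF S]) (use fin in auto)
      also have "\<dots> = a F - a F0"
        using fin by (simp add: a_def sum_diff)
      also have "\<dots> < (e/2)\<^sup>2"
        using F0(2) cSup_upper[OF _ bdd, of "a F"] fin by (auto simp: FF_def)
      finally show ?thesis
        by (rule power_less_imp_less_base) (use \<open>e > 0\<close> in simp)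
    qed
    have "eventually R (finite_subsets_at_top S)"
      using F0(1) unfolding eventually_finite_subsets_at_top R_def FF_def by blast
    moreover have "dist (sum f F) (sum f F') < e" if "R F" "R F'" for F F'
      using near[OF that(1)] near[OF that(2)]
        dist_triangle_half_l[of "sum f F" "sum f F0" e "sum f F'"]
      by (simp add: dist_commute)
    ultimately show ?thesis by blast
  qed
  then have "cauchy_filter (filtermap (sum f) (finite_subsets_at_top S))"
    by (simp add: cauchy_filter_metric_filtermap)
  moreover have "complete (UNIV::'a set)"
    by (meson Cauchy_convergent UNIV_I complete_def convergent_def)
  ultimately obtain L where "(sum f \<longlongrightarrow> L) (finite_subsets_at_top S)"
    using complete_uniform[where S=UNIV] by (force simp add: filterlim_def)
  then show ?thesis
    unfolding f_def summable_on_def has_sum_def by blast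
qed

lemma cinner_orthonormal_expansion:
  assumes S: "orthonormal_on S (\<lambda>j. j)" and sum: "((\<lambda>j. c j *\<^sub>C j) has_sum z) S" and k: "k \<in> S"
  shows "cinner z k = c k"
proof (rule has_sum_unique)
  show "((\<lambda>j. cinner (c j *\<^sub>C j) k) has_sum cinner z k) S"
    using has_sum_bounded_linear[OF bounded_linear_cinner_left sum] .
  show "((\<lambda>j. cinner (c j *\<^sub>C j) k) has_sum c k) S"
    using S k by (intro has_sum_finite_neutralI[of "{k}"])
      (auto simp: orthonormal_on_def cinner_scaleC_left)
qed

text \<open>Bessel makes the series converge to some \<open>z\<close> in \<open>M\<close>. The
  remainder \<open>w - z\<close> lies in \<open>M\<close> and is orthogonal to \<open>S\<close>, so
  totality within \<open>M\<close> removes it.\<close>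

lemma orthonormal_expansion:
  fixes M :: "'a::complex_hilbert set"
  assumes M: "complex_vector.subspace M" "closed M"
    and S: "S \<subseteq> M" "orthonormal_on S (\<lambda>j. j)"
    and total: "\<And>y. y \<in> M \<Longrightarrow> (\<And>j. j \<in> S \<Longrightarrow> cinner y j = 0) \<Longrightarrow> y = 0"
    and w: "w \<in> M"
  shows "((\<lambda>j. cinner w j *\<^sub>C j) has_sum w) S"
proof -
  obtain z where z: "((\<lambda>j. cinner w j *\<^sub>C j) has_sum z) S"
    using orthonormal_summable[OF S(2) Bessel_inequality[OF S(2)]] by (auto simp: summable_on_def)
  have "z \<in> M"
    by (rule has_sum_mem_closed[OF M(2) z])
      (use S(1) M(1) in \<open>auto intro!: complex_vector.subspace_sum complex_vector.subspace_scale\<close>)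
  then have "w - z = 0"
    using cinner_orthonormal_expansion[OF S(2) z]
    by (intro total complex_vector.subspace_diff M w) (auto simp: cinner_diff_left)
  then show ?thesis using z by simp
qed

text \<open>Zorn's lemma. \<open>G\<close> need not be a subspace, so maximality speaks only of unit
  vectors of \<open>G\<close> itself; this suffices for a union of eigenspaces.\<close>

lemma exists_maximal_orthonormal_subset:
  "\<exists>J\<subseteq>G. orthonormal_on J (\<lambda>j. j) \<and>
     (\<forall>x\<in>G. norm x = 1 \<longrightarrow> (\<exists>j\<in>J. cinner x j \<noteq> 0))"
proof -
  define \<A> where "\<A> = {J. J \<subseteq> G \<and> orthonormal_on J (\<lambda>j. j)}"
  have "\<Union>\<C> \<in> \<A>" if "subset.chain \<A> \<C>" for \<C>
  proof -
    have ch: "\<C> \<subseteq> \<A>" "\<And>X Y. X \<in> \<C> \<Longrightarrow> Y \<in> \<C> \<Longrightarrow> X \<subseteq> Y \<or> Y \<subseteq> X"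
      using that by (auto simp: subset.chain_def)
    have "cinner i j = (if i = j then 1 else 0)" if ij: "i \<in> X" "X \<in> \<C>" "j \<in> Y" "Y \<in> \<C>" for i j X Y
    proof -
      obtain Z where "Z \<in> \<C>" "i \<in> Z" "j \<in> Z"
        using ch(2)[OF ij(2,4)] ij by blast
      then show ?thesis using ch(1) by (auto simp: \<A>_def orthonormal_on_def)
    qed
    then show ?thesis using ch(1) by (auto simp: \<A>_def orthonormal_on_def)
  qed
  from subset_Zorn'[OF this] obtain J
    where J: "J \<in> \<A>" "\<And>X. X \<in> \<A> \<Longrightarrow> J \<subseteq> X \<Longrightarrow> X = J" by blast
  have "\<exists>j\<in>J. cinner x j \<noteq> 0" if x: "x \<in> G" "norm x = 1" for x
  proof (rule ccontr)
    assume "\<not> ?thesis"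
    then have 0: "cinner x j = 0" "cinner j x = 0" if "j \<in> J" for j
      using that cinner_commute[of j x] by auto
    have 1: "cinner x x = 1" using x(2) by (simp add: norm_eq_1_iff_cinner)
    have "insert x J \<in> \<A>"
      using J(1) x(1) 0 1 by (auto simp: \<A>_def orthonormal_on_def)
    then have "x \<in> J" using J(2) by blast
    then show False using 0 1 by force
  qed
  then show ?thesis using J(1) by (auto simp: \<A>_def)
qed

section \<open>Two projections\<close>

lemma orthogonal_projectionD:
  assumes "orthogonal_projection P"
  shows "bounded_linear P" and "P (x + y) = P x + P y" and "P (x - y) = P x - P y"
    and "P (c *\<^sub>C x) = c *\<^sub>C P x" and "P (P x) = P x" and "cinner (P x) y = cinner x (P y)"
    and "P 0 = 0"
proof -
  show P: "bounded_linear P" "P (c *\<^sub>C x) = c *\<^sub>C P x" "cinner (P x) y = cinner x (P y)"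
    using assms by (auto simp: orthogonal_projection_def self_adjoint_def bounded_clinear_def)
  show "P (P x) = P x"
    using assms by (auto simp: orthogonal_projection_def dest: fun_cong[of "P \<circ> P"])
  show "P (x + y) = P x + P y" "P (x - y) = P x - P y" "P 0 = 0"
    using P(1) by (auto simp: linear_simps)
qed

lemma norm_orthogonal_projection_le:
  assumes "orthogonal_projection P"
  shows "norm (P x) \<le> norm x"
proof (cases "P x = 0")
  case False
  have "cinner (P x) (P x) = cinner (P x) x"
    by (simp add: orthogonal_projectionD[OF assms])
  then have "(norm (P x))\<^sup>2 = cmod (cinner (P x) x)"
    by (metis cinner_self norm_of_real abs_of_nonneg zero_le_power2)
  also have "\<dots> \<le> norm (P x) * norm x"
    by (rule cmod_cinner_le)
  finally show ?thesis
    using False by (simp add: power2_eq_square)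
qed simp

locale projection_pair =
  fixes P Q :: "'a::complex_hilbert \<Rightarrow> 'a"
  assumes P: "orthogonal_projection P" and Q: "orthogonal_projection Q"
begin

lemmas P_simps = orthogonal_projectionD(2-5,7)[OF P]
lemmas Q_simps = orthogonal_projectionD(2-5,7)[OF Q]
lemmas P_adjoint = orthogonal_projectionD(6)[OF P]
lemmas Q_adjoint = orthogonal_projectionD(6)[OF Q]

text \<open>The parameter is complex because it arises as \<open>1 - \<mu>\<^sup>2\<close> from an
  eigenvalue not yet known to be real.\<close>

definition M :: "complex \<Rightarrow> 'a set"
  where "M r = {x. Q x = x \<and> Q (P x) = r *\<^sub>C x}"

lemma subspace_M: "complex_vector.subspace (M r)"
  by (auto simp: complex_vector.subspace_def M_def P_simps Q_simps scaleC_add_right scaleC_scaleC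
      mult.commute)

lemma closed_M: "closed (M r)"
  unfolding M_def
  by (intro closed_Collect_conj closed_Collect_eq continuous_intros
      bounded_linear.continuous_on[OF bounded_linear_scaleC_right]
      bounded_linear.continuous_on[OF orthogonal_projectionD(1)[OF P]]
      bounded_linear.continuous_on[OF orthogonal_projectionD(1)[OF Q]])

text \<open>A \<open>y\<close> in the range of \<open>Q\<close> cannot distinguish
  \<open>P x\<close> from \<open>Q (P x)\<close>, which is a multiple of \<open>x\<close>. The later
  computations of inner products rest on this.\<close>

lemma cinner_P_M:
  assumes "x \<in> M r" "Q y = y"
  shows "cinner (P x) y = r * cinner x y"
proof -
  have "cinner (P x) y = cinner (Q (P x)) y"
    using assms(2) by (simp add: Q_adjoint)
  then show ?thesis
    using assms(1) by (simp add: M_def cinner_scaleC_left)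
qed

lemma norm_P_M:
  assumes "x \<in> M r"
  shows "complex_of_real ((norm (P x))\<^sup>2) = r * complex_of_real ((norm x)\<^sup>2)"
proof -
  have "cinner (P x) (P x) = cinner (P x) x"
    by (metis P_adjoint P_simps(4))
  also have "\<dots> = r * cinner x x"
    using assms by (intro cinner_P_M) (auto simp: M_def)
  finally show ?thesis by (simp only: cinner_self)
qed

lemma M_nonzero_Reals:
  assumes "x \<in> M r" "x \<noteq> 0"
  shows "cnj r = r"
proof -
  have "r = complex_of_real ((norm (P x))\<^sup>2 / (norm x)\<^sup>2)"
    using norm_P_M[OF assms(1)] assms(2) by (simp add: field_simps)
  then show ?thesis by (metis complex_cnj_complex_of_real)
qed

text \<open>Moving \<open>P\<close> from one argument to the other gives the factor \<open>r\<close>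
  on one side and \<open>cnj r'\<close> on the other; \<open>r'\<close> is real because
  \<open>y\<close> is nonzero.\<close>

lemma orthogonal_M:
  assumes x: "x \<in> M r" and y: "y \<in> M r'" and ne: "r \<noteq> r'"
  shows "cinner x y = 0"
proof (rule ccontr)
  assume nz: "cinner x y \<noteq> 0"
  have "r * cinner x y = cinner (P x) y"
    using x y by (intro cinner_P_M[symmetric]) (auto simp: M_def)
  also have "\<dots> = cnj (cinner (P y) x)"
    by (metis P_adjoint cinner_commute)
  also have "\<dots> = cnj r' * cinner x y"
    using x y by (subst cinner_P_M[of y r']) (auto simp: M_def cinner_commute[of x y])
  finally have "r = cnj r'" using nz by simp
  moreover have "y \<noteq> 0" using nz by auto
  ultimately show False using M_nonzero_Reals[OF y] ne by simp
qed

text \<open>Apply \<open>P\<close> and \<open>Q\<close> in turn to the eigenvalue equation. The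
  eigenvalues 1 and -1 lead to \<open>M 0\<close>, which yields no singular value, while the kernel
  of \<open>P - Q\<close> leads to \<open>M 1\<close>, the source of the singular value 1.\<close>

lemma eigenvector_image:
  assumes "P x - Q x = \<mu> *\<^sub>C x"
  shows "P (Q x) = (1 - \<mu>) *\<^sub>C P x" and "Q x \<in> M (1 - \<mu>\<^sup>2)"
proof -
  have "P (P x - Q x) = \<mu> *\<^sub>C P x" by (simp add: assms P_simps)
  then show PQ: "P (Q x) = (1 - \<mu>) *\<^sub>C P x"
    by (simp add: P_simps complex_vector.scale_left_diff_distrib algebra_simps)
  have "Q (P x - Q x) = \<mu> *\<^sub>C Q x" by (simp add: assms Q_simps)
  then have "Q (P x) = (1 + \<mu>) *\<^sub>C Q x"
    by (simp add: Q_simps scaleC_add_left algebra_simps)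
  then show "Q x \<in> M (1 - \<mu>\<^sup>2)"
    by (simp add: M_def PQ Q_simps scaleC_scaleC algebra_simps power2_eq_square)
qed

end

section \<open>Singular vectors of \<open>P \<circ> Q\<close> from a maximal orthonormal
  system\<close>

locale singular_system = projection_pair +
  fixes J
  assumes J_M: "J \<subseteq> (\<Union>r\<in>-{0}. M r)"
    and J_orthonormal: "orthonormal_on J (\<lambda>j. j)"
    and J_maximal: "\<And>x. x \<in> (\<Union>r\<in>-{0}. M r) \<Longrightarrow> norm x = 1 \<Longrightarrow> \<exists>j\<in>J. cinner x j \<noteq> 0"
begin

lemma norm_J: "j \<in> J \<Longrightarrow> norm j = 1"
  using J_orthonormal by (simp add: orthonormal_on_def flip: norm_eq_1_iff_cinner)

lemma singular_value_unique:
  assumes "j \<in> J" "j \<in> M r"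
  shows "complex_of_real ((norm (P j))\<^sup>2) = r"
  using norm_P_M[OF assms(2)] norm_J[OF assms(1)] by simp

text \<open>Each \<open>j\<close> determines its own parameter as the squared norm of
  \<open>P j\<close>. Leaving \<open>M 0\<close> out of the union makes this norm positive, as a
  singular value must be.\<close>

lemma J_singular_value:
  assumes "j \<in> J"
  shows "j \<in> M (complex_of_real ((norm (P j))\<^sup>2))" and "0 < norm (P j)" and "norm (P j) \<le> 1"
proof -
  obtain r where r: "r \<noteq> 0" "j \<in> M r" using J_M assms by auto
  have *: "complex_of_real ((norm (P j))\<^sup>2) = r"
    using singular_value_unique[OF assms r(2)] .
  show "j \<in> M (complex_of_real ((norm (P j))\<^sup>2))" using r(2) unfolding * .
  show "0 < norm (P j)" using * r(1) by auto
  show "norm (P j) \<le> 1"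
    using norm_orthogonal_projection_le[OF P, of j] norm_J[OF assms] by simp
qed

lemma J_Int_M:
  assumes "0 \<le> a"
  shows "J \<inter> M (complex_of_real (a\<^sup>2)) = {j \<in> J. norm (P j) = a}"
proof (intro set_eqI iffI)
  fix j assume j: "j \<in> J \<inter> M (complex_of_real (a\<^sup>2))"
  then have "complex_of_real ((norm (P j))\<^sup>2) = complex_of_real (a\<^sup>2)"
    by (intro singular_value_unique) auto
  then have "(norm (P j))\<^sup>2 = a\<^sup>2" using of_real_eq_iff by blast
  then show "j \<in> {j \<in> J. norm (P j) = a}" using assms j by simp
qed (use J_singular_value in auto)

text \<open>Maximality concerns all of \<open>J\<close>, not its part in one eigenspace. A vector of
  \<open>M r\<close> is however automatically orthogonal to the members of \<open>J\<close> outside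
  \<open>M r\<close>, since these lie in eigenspaces for other parameters.\<close>

lemma expansion_M:
  assumes r: "r \<noteq> 0" and w: "w \<in> M r"
  shows "((\<lambda>j. cinner w j *\<^sub>C j) has_sum w) (J \<inter> M r)"
proof (rule orthonormal_expansion[OF subspace_M closed_M _ _ _ w])
  show "orthonormal_on (J \<inter> M r) (\<lambda>j. j)"
    using J_orthonormal by (simp add: orthonormal_on_def)
  fix y assume y: "y \<in> M r" and 0: "\<And>j. j \<in> J \<inter> M r \<Longrightarrow> cinner y j = 0"
  have J0: "cinner y j = 0" if "j \<in> J" for j
  proof (cases "j \<in> M r")
    case False
    then show ?thesis
      using orthogonal_M[OF y J_singular_value(1)[OF that]] J_singular_value(1)[OF that] by metis
  qed (use 0 that in auto)
  show "y = 0"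
  proof (rule ccontr)
    assume "y \<noteq> 0"
    define x where "x = complex_of_real (1 / norm y) *\<^sub>C y"
    have "x \<in> M r" unfolding x_def
      by (intro complex_vector.subspace_scale subspace_M y)
    moreover have "norm x = 1" using \<open>y \<noteq> 0\<close> by (simp add: x_def norm_scaleC norm_divide)
    ultimately obtain j where "j \<in> J" "cinner x j \<noteq> 0" using J_maximal r by blast
    then show False using J0 by (simp add: x_def cinner_scaleC_left)
  qed
qed simp

text \<open>This is where totality of the eigenvectors of \<open>P - Q\<close> enters. Tested
  against an eigenvector \<open>b\<close>, the vector \<open>Q (P y)\<close> gives a multiple of
  \<open>cinner (Q b) y\<close>, and \<open>Q b\<close> expands in \<open>J\<close>. So
  \<open>Q (P y)\<close> vanishes, and with it the squared norm of \<open>P y\<close>.\<close>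

lemma P_eq_0:
  assumes B: "closure (complex_vector.span B) = UNIV"
      "\<And>b. b \<in> B \<Longrightarrow> \<exists>\<mu>. P b - Q b = \<mu> *\<^sub>C b"
    and y: "Q y = y" "\<And>j. j \<in> J \<Longrightarrow> cinner j y = 0"
  shows "P y = 0"
proof -
  have "Q (P y) = 0"
  proof (rule eq_0_if_orthogonal_to_dense_span[OF B(1)])
    fix b assume "b \<in> B"
    then obtain \<mu> where mu: "P b - Q b = \<mu> *\<^sub>C b" using B(2) by blast
    note QbM = eigenvector_image(2)[OF mu]
    have "cinner b (Q (P y)) = cinner (P (Q b)) y"
      by (simp add: P_adjoint Q_adjoint)
    also have "\<dots> = (1 - \<mu>\<^sup>2) * cinner (Q b) y"
      by (rule cinner_P_M[OF QbM y(1)])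
    also have "\<dots> = 0"
    \<comment> \<open>When \<open>\<mu>\<^sup>2 = 1\<close>, the vector \<open>Q b\<close> lies in
      \<open>M 0\<close> and has no expansion in \<open>J\<close>, but then the factor in front is
      0.\<close>
    proof (cases "1 - \<mu>\<^sup>2 = 0")
      case False
      have "((\<lambda>j. cinner (cinner (Q b) j *\<^sub>C j) y) has_sum cinner (Q b) y) (J \<inter> M (1 - \<mu>\<^sup>2))"
        by (rule has_sum_bounded_linear[OF bounded_linear_cinner_left expansion_M[OF False QbM]])
      moreover have "((\<lambda>j. cinner (cinner (Q b) j *\<^sub>C j) y) has_sum 0) (J \<inter> M (1 - \<mu>\<^sup>2))"
        by (rule has_sum_0) (simp add: cinner_scaleC_left y(2))
      ultimately show ?thesis using has_sum_unique by fastforce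
    qed simp
    finally show "cinner b (Q (P y)) = 0" .
  qed
  moreover have "cinner (P y) (P y) = cinner (Q (P y)) y"
    by (simp add: P_adjoint Q_adjoint P_simps y(1))
  ultimately show ?thesis by simp
qed

text \<open>Let \<open>z\<close> be the expansion of \<open>Q x\<close> along \<open>J\<close>. By
  \<open>P_eq_0\<close> the remainder \<open>Q x - z\<close> is killed by \<open>P\<close>, so
  \<open>P (Q x) = P z\<close>, and applying \<open>P\<close> termwise to the series for
  \<open>z\<close> gives the decomposition. The left vectors are orthonormal because
  \<open>P\<close> scales the inner products of members of \<open>J\<close>.\<close>

lemma singular_value_decomposition_PQ:
  assumes B: "closure (complex_vector.span B) = UNIV"
      "\<And>b. b \<in> B \<Longrightarrow> \<exists>\<mu>. P b - Q b = \<mu> *\<^sub>C b"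
  shows "singular_value_decomposition (P \<circ> Q) J (\<lambda>j. norm (P j)) (\<lambda>j. j)
    (\<lambda>j. complex_of_real (1 / norm (P j)) *\<^sub>C P j)"
  unfolding singular_value_decomposition_def
proof (intro conjI ballI allI)
  show "orthonormal_on J (\<lambda>j. complex_of_real (1 / norm (P j)) *\<^sub>C P j)"
    unfolding orthonormal_on_def
  proof (intro ballI)
    fix i j assume ij: "i \<in> J" "j \<in> J"
    have "cinner (P i) (P j) = cinner (P i) j"
      by (metis P_adjoint P_simps(4))
    also have "\<dots> = complex_of_real ((norm (P i))\<^sup>2) * cinner i j"
      using J_singular_value(1)[OF ij(2)] by (intro cinner_P_M J_singular_value ij) (simp add: M_def)
    finally show "cinner (complex_of_real (1 / norm (P i)) *\<^sub>C P i)
        (complex_of_real (1 / norm (P j)) *\<^sub>C P j) = (if i = j then 1 else 0)"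
      using J_singular_value(2)[OF ij(1)] J_orthonormal ij
      by (auto simp: orthonormal_on_def cinner_scaleC_left cinner_scaleC_right power2_eq_square)
  qed
  fix x
  obtain z where z: "((\<lambda>j. cinner (Q x) j *\<^sub>C j) has_sum z) J"
    using orthonormal_summable[OF J_orthonormal Bessel_inequality[OF J_orthonormal]]
    by (auto simp: summable_on_def)
  have QJ: "Q j = j" if "j \<in> J" for j
    using J_singular_value(1)[OF that] by (simp add: M_def)
  \<comment> \<open>\<open>P_eq_0\<close> needs a vector in the range of \<open>Q\<close>;
    \<open>z\<close> is one because \<open>Q\<close> fixes every term of its series.\<close>
  have "((\<lambda>j. Q (cinner (Q x) j *\<^sub>C j)) has_sum Q z) J"
    by (rule has_sum_bounded_linear[OF orthogonal_projectionD(1)[OF Q] z])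
  then have "((\<lambda>j. cinner (Q x) j *\<^sub>C j) has_sum Q z) J"
    by (subst has_sum_cong[where g = "\<lambda>j. Q (cinner (Q x) j *\<^sub>C j)"]) (auto simp: Q_simps QJ)
  then have "Q z = z" using z has_sum_unique by blast
  have "P (Q x - z) = 0"
  proof (rule P_eq_0[OF B])
    fix j assume "j \<in> J"
    then have "cinner (Q x - z) j = 0"
      by (simp add: cinner_diff_left cinner_orthonormal_expansion[OF J_orthonormal z])
    then show "cinner j (Q x - z) = 0" by (metis cinner_commute complex_cnj_zero)
  qed (simp_all add: Q_simps \<open>Q z = z\<close>)
  then have Pz: "P z = (P \<circ> Q) x" by (simp add: P_simps)
  have PQ: "((\<lambda>j. P (cinner (Q x) j *\<^sub>C j)) has_sum P z) J"
    by (rule has_sum_bounded_linear[OF orthogonal_projectionD(1)[OF P] z])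
  have "P (cinner (Q x) j *\<^sub>C j) = (complex_of_real (norm (P j)) * cinner x j) *\<^sub>C
      complex_of_real (1 / norm (P j)) *\<^sub>C P j" if "j \<in> J" for j
    using J_singular_value(2)[OF that] QJ[OF that]
    by (simp add: P_simps Q_adjoint scaleC_scaleC)
  then show "((\<lambda>j. (complex_of_real (norm (P j)) * cinner x j) *\<^sub>C
      complex_of_real (1 / norm (P j)) *\<^sub>C P j) has_sum (P \<circ> Q) x) J"
    using PQ unfolding Pz by (rule has_sum_cong[THEN iffD1])
qed (use J_orthonormal J_singular_value in auto)

text \<open>On the range of \<open>Q\<close>, \<open>P - (1 - \<lambda>)\<close> agrees with \<open>(P - Q) + \<lambda>\<close>, so by
  \<open>(A - \<lambda>) (A + \<lambda>) = A\<^sup>2 - \<lambda>\<^sup>2\<close> it maps \<open>M (1 - \<lambda>\<^sup>2)\<close> into the eigenspace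
  of \<open>A = P - Q\<close> for \<open>\<lambda>\<close>.  It multiplies inner products by the constant \<open>2 \<lambda>\<^sup>2 (1 - \<lambda>)\<close>.\<close>

lemma eigenspace_basis:
  fixes l :: real
  defines "J' \<equiv> {j \<in> J. norm (P j) = sqrt (1 - l\<^sup>2)}"
  assumes l: "l \<noteq> 0" "\<bar>l\<bar> < 1"
  shows "\<exists>B. orthonormal_basis B (eigenspace (\<lambda>x. P x - Q x) (complex_of_real l)) \<and> B \<approx> J'"
proof -
  let ?l = "complex_of_real l"
  let ?E = "eigenspace (\<lambda>x. P x - Q x) ?l"
  \<comment> \<open>On \<open>M r\<close>, expanding the inner product of \<open>V x\<close> and
    \<open>V y\<close> gives the factor \<open>r - 2 * (1 - l) * r + (1 - l)\<^sup>2\<close>, which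
    is \<open>k\<close> when \<open>r = 1 - l\<^sup>2\<close>. The scalar \<open>c\<close> below
    normalizes it to 1.\<close>
  define k where "k = 2 * l\<^sup>2 * (1 - l)"
  have l2: "l\<^sup>2 < 1" using l(2) by (simp add: abs_square_less_1)
  have k: "k > 0" using l by (simp add: k_def)
  define r where "r = 1 - ?l\<^sup>2"
  have r: "r = complex_of_real ((sqrt (1 - l\<^sup>2))\<^sup>2)" using l2 by (simp add: r_def)
  have J': "J' = J \<inter> M r"
    unfolding J'_def r using l2 by (intro J_Int_M[symmetric]) simp
  have r0: "r \<noteq> 0"
    using l2 by (simp add: r_def) (metis of_real_1 of_real_eq_iff of_real_power less_irrefl)
  define V where "V x = P x - (1 - ?l) *\<^sub>C x" for x
  define c where "c = complex_of_real (1 / sqrt k)"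
  have cV: "c * cnj c * complex_of_real k = 1"
    using k by (simp add: c_def flip: of_real_mult)
  have linV: "bounded_linear V" unfolding V_def
    by (intro bounded_linear_sub orthogonal_projectionD(1)[OF P] bounded_linear_scaleC_right)
  have V_scale: "V (a *\<^sub>C x) = a *\<^sub>C V x" for a x
    by (simp add: V_def P_simps complex_vector.scale_right_diff_distrib scaleC_scaleC mult.commute)
  have V_E: "V x \<in> ?E" if "x \<in> M r" for x
  proof -
    have "P (V x) - Q (V x) = (P x - (1 - ?l) *\<^sub>C P x) - (r *\<^sub>C x - (1 - ?l) *\<^sub>C x)"
      using that by (simp add: V_def P_simps Q_simps M_def)
    also have "\<dots> = ?l *\<^sub>C P x - (?l * (1 - ?l)) *\<^sub>C x"
      by (simp add: r_def complex_vector.scale_left_diff_distrib algebra_simps power2_eq_square)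
    also have "\<dots> = ?l *\<^sub>C V x"
      by (simp add: V_def complex_vector.scale_right_diff_distrib scaleC_scaleC)
    finally show ?thesis by (simp add: eigenspace_def)
  qed
  have V_cinner: "cinner (V x) (V y) = complex_of_real k * cinner x y"
    if "x \<in> M r" "y \<in> M r" for x y
  proof -
    have xy: "cinner (P x) y = r * cinner x y" "cinner x (P y) = r * cinner x y"
      "cinner (P x) (P y) = r * cinner x y"
      using cinner_P_M[of x r y] that P_adjoint[of x "P y"] P_adjoint[of x y]
      by (auto simp: M_def P_simps)
    show ?thesis
      unfolding V_def cinner_diff_left cinner_diff_right cinner_scaleC_left cinner_scaleC_right xy
      by (simp add: r_def k_def algebra_simps power2_eq_square power3_eq_cube)
  qed
  \<comment> \<open>Surjectivity: up to the nonzero scalar \<open>l * (1 - l)\<close>,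
    \<open>Q\<close> is a right inverse of \<open>V\<close> on the eigenspace. Expanding
    \<open>Q x\<close> in \<open>J'\<close> and applying \<open>V\<close> thus expands
    \<open>x\<close> in the image system.\<close>
  have Q_V: "V (Q x) = (?l * (1 - ?l)) *\<^sub>C x" if "x \<in> ?E" for x
  proof -
    have ev: "P x - Q x = ?l *\<^sub>C x" using that by (simp add: eigenspace_def)
    have "V (Q x) = (1 - ?l) *\<^sub>C (P x - Q x)"
      by (simp add: V_def eigenvector_image(1)[OF ev] complex_vector.scale_right_diff_distrib)
    then show ?thesis by (simp add: ev scaleC_scaleC mult.commute)
  qed
  define B where "B = (\<lambda>j. c *\<^sub>C V j) ` J'"
  have orth: "cinner (c *\<^sub>C V i) (c *\<^sub>C V j) = (if i = j then 1 else 0)"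
    if "i \<in> J'" "j \<in> J'" for i j
  proof -
    have "cinner (c *\<^sub>C V i) (c *\<^sub>C V j) = (c * cnj c * complex_of_real k) * cinner i j"
      using that J' by (simp add: cinner_scaleC_left cinner_scaleC_right V_cinner)
    then show ?thesis using that J' J_orthonormal by (simp add: cV orthonormal_on_def)
  qed
  have inj: "inj_on (\<lambda>j. c *\<^sub>C V j) J'"
    by (rule inj_onI) (metis orth zero_neq_one)
  have A_add: "P (x + y) - Q (x + y) = (P x - Q x) + (P y - Q y)" for x y
    by (simp add: P_simps Q_simps)
  have A_scale: "P (a *\<^sub>C x) - Q (a *\<^sub>C x) = a *\<^sub>C (P x - Q x)" for a x
    by (simp add: P_simps Q_simps complex_vector.scale_right_diff_distrib)
  have sub_E: "complex_vector.subspace ?E"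
    by (simp add: complex_vector.subspace_def eigenspace_def A_add A_scale scaleC_add_right
        scaleC_scaleC P_simps(5) Q_simps(5) mult.commute)
  have closed_E: "closed ?E"
    unfolding eigenspace_def
    by (intro closed_Collect_eq continuous_intros
        bounded_linear.continuous_on[OF bounded_linear_scaleC_right]
        bounded_linear.continuous_on[OF orthogonal_projectionD(1)[OF P]]
        bounded_linear.continuous_on[OF orthogonal_projectionD(1)[OF Q]])
  have "closure (complex_vector.span B) \<subseteq> ?E"
    by (intro closure_minimal complex_vector.span_minimal sub_E closed_E)
      (auto simp: B_def J' intro!: complex_vector.subspace_scale sub_E V_E)
  moreover have "x \<in> closure (complex_vector.span B)" if x: "x \<in> ?E" for x
  proof -
    define a where "a = 1 / (?l * (1 - ?l))"
    have a: "x = a *\<^sub>C V (Q x)"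
      using l by (auto simp: Q_V[OF x] scaleC_scaleC a_def)
    have "Q x \<in> M r"
      unfolding r_def using x by (intro eigenvector_image) (simp add: eigenspace_def)
    then have "((\<lambda>j. a *\<^sub>C V (cinner (Q x) j *\<^sub>C j)) has_sum x) J'"
      unfolding J' by (subst (2) a)
        (intro has_sum_bounded_linear[OF bounded_linear_scaleC_right]
          has_sum_bounded_linear[OF linV] expansion_M r0)
    then show ?thesis
    proof (rule has_sum_mem_closed[OF closed_closure])
      fix F assume F: "F \<subseteq> J'"
      have "V j \<in> complex_vector.span B" if "j \<in> F" for j
      proof -
        have "c *\<^sub>C V j \<in> complex_vector.span B"
          using that F by (intro complex_vector.span_base) (auto simp: B_def)
        then have "(1 / c) *\<^sub>C c *\<^sub>C V j \<in> complex_vector.span B"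
          by (rule complex_vector.span_scale)
        moreover have "c \<noteq> 0" using cV by auto
        ultimately show ?thesis by (simp add: scaleC_scaleC)
      qed
      then have "(\<Sum>j\<in>F. a *\<^sub>C V (cinner (Q x) j *\<^sub>C j)) \<in> complex_vector.span B"
        unfolding V_scale by (intro complex_vector.span_sum complex_vector.span_scale)
      then show "(\<Sum>j\<in>F. a *\<^sub>C V (cinner (Q x) j *\<^sub>C j)) \<in> closure (complex_vector.span B)"
        using closure_subset by blast
    qed
  qed
  ultimately have "closure (complex_vector.span B) = ?E" by blast
  moreover have "orthonormal_on B (\<lambda>b. b)"
    using orth inj by (auto simp: B_def orthonormal_on_def inj_on_def)
  moreover have "B \<approx> J'"
    unfolding B_def by (rule inj_on_image_eqpoll_self[OF inj])
  ultimately show ?thesis unfolding orthonormal_basis_def by blast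
qed

end

section \<open>Matching the eigenvalues with the singular values\<close>

theorem theorem2p4:
  fixes P Q A :: "'a::complex_hilbert \<Rightarrow> 'a"
    and I :: "'i set" and lam :: "'i \<Rightarrow> real"
  assumes "orthogonal_projection P" and "orthogonal_projection Q"
    and "A = (\<lambda>x. P x - Q x)"
    and "diagonalizable A"
    and "\<And>n. n \<in> I \<Longrightarrow> 0 < \<bar>lam n\<bar> \<and> \<bar>lam n\<bar> < 1"
    and "(\<Union>n\<in>I. {complex_of_real (lam n), - complex_of_real (lam n)}) \<subseteq> {\<mu>. eigenvalue A \<mu> \<and> \<mu> \<noteq> 0}"
    and "{\<mu>. eigenvalue A \<mu> \<and> \<mu> \<noteq> 0} \<subseteq>
           (\<Union>n\<in>I. {complex_of_real (lam n), - complex_of_real (lam n)}) \<union> {1, - 1}"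
  shows "\<exists>(J :: 'a set) s. S_decomposable_with (P \<circ> Q) J s \<and>
           (\<lambda>n. sqrt (1 - (lam n)\<^sup>2)) ` I \<subseteq> s ` J \<and>
           s ` J \<subseteq> (\<lambda>n. sqrt (1 - (lam n)\<^sup>2)) ` I \<union> {1} \<and>
           (\<forall>n\<in>I. \<exists>B. orthonormal_basis B (eigenspace A (complex_of_real (lam n))) \<and>
                      B \<approx> {j \<in> J. s j = sqrt (1 - (lam n)\<^sup>2)})"
proof -
  interpret projection_pair P Q using assms(1,2) by unfold_locales
  obtain J where J: "J \<subseteq> (\<Union>r\<in>-{0}. M r)" "orthonormal_on J (\<lambda>j. j)"
      "\<forall>x\<in>(\<Union>r\<in>-{0}. M r). norm x = 1 \<longrightarrow> (\<exists>j\<in>J. cinner x j \<noteq> 0)"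
    using exists_maximal_orthonormal_subset[of "\<Union>r\<in>-{0}. M r"] by (elim exE conjE)
  interpret singular_system P Q J
    by unfold_locales (fact J(1), fact J(2), rule J(3)[rule_format])
  let ?s = "\<lambda>j. norm (P j)"
  have PQ: "bounded_clinear (P \<circ> Q)"
    using bounded_linear_compose[of P Q] assms(1,2)
    by (auto simp: bounded_clinear_def orthogonal_projectionD comp_def)
  obtain B where B: "orthonormal_basis B UNIV" "\<And>b. b \<in> B \<Longrightarrow> \<exists>\<mu>. eigenvector A \<mu> b"
    using assms(4) by (auto simp: diagonalizable_def)
  have "singular_value_decomposition (P \<circ> Q) J ?s (\<lambda>j. j)
      (\<lambda>j. complex_of_real (1 / ?s j) *\<^sub>C P j)"
    using B by (intro singular_value_decomposition_PQ[of B])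
      (auto simp: orthonormal_basis_def eigenvector_def eigenspace_def assms(3))
  then have dec: "S_decomposable_with (P \<circ> Q) J ?s"
    using PQ by (auto simp: S_decomposable_with_def)
  have basis: "\<exists>B. orthonormal_basis B (eigenspace A (complex_of_real l)) \<and>
      B \<approx> {j \<in> J. ?s j = sqrt (1 - l\<^sup>2)}" if "l \<noteq> 0" "\<bar>l\<bar> < 1" for l
    using eigenspace_basis[OF that] by (simp add: assms(3))
  \<comment> \<open>The closed span of the empty set is zero, so the eigenspace is nonzero exactly
    when its basis is nonempty, hence when the equipollent set of singular vectors is.\<close>
  have ev_iff: "eigenvalue A (complex_of_real l) \<longleftrightarrow> sqrt (1 - l\<^sup>2) \<in> ?s ` J"
    if l: "l \<noteq> 0" "\<bar>l\<bar> < 1" for l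
  proof -
    obtain B where B: "orthonormal_on B (\<lambda>b. b)"
      "closure (complex_vector.span B) = eigenspace A (complex_of_real l)"
      "B \<approx> {j \<in> J. ?s j = sqrt (1 - l\<^sup>2)}"
      using basis[OF l] by (auto simp: orthonormal_basis_def)
    have "eigenvalue A (complex_of_real l) \<longleftrightarrow> B \<noteq> {}"
    proof
      assume "B \<noteq> {}"
      then obtain b where "b \<in> B" by blast
      then have "b \<noteq> 0" "b \<in> eigenspace A (complex_of_real l)"
        using B(1) closure_subset complex_vector.span_base unfolding B(2)[symmetric]
        by (force simp: orthonormal_on_def, blast)
      then show "eigenvalue A (complex_of_real l)"
        by (auto simp: eigenvalue_def eigenvector_def)
    next
      assume "eigenvalue A (complex_of_real l)"
      then obtain x where "x \<noteq> 0" "x \<in> closure (complex_vector.span B)"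
        by (auto simp: eigenvalue_def eigenvector_def B(2))
      then show "B \<noteq> {}" by auto
    qed
    also have "\<dots> \<longleftrightarrow> {j \<in> J. ?s j = sqrt (1 - l\<^sup>2)} \<noteq> {}"
      using B(3) by (metis eqpoll_empty_iff_empty eqpoll_sym)
    also have "\<dots> \<longleftrightarrow> sqrt (1 - l\<^sup>2) \<in> ?s ` J" by force
    finally show ?thesis .
  qed
  have "(\<lambda>n. sqrt (1 - (lam n)\<^sup>2)) ` I \<subseteq> ?s ` J"
  proof (intro image_subsetI)
    fix n assume n: "n \<in> I"
    then have "eigenvalue A (complex_of_real (lam n))" using assms(6) by auto
    then show "sqrt (1 - (lam n)\<^sup>2) \<in> ?s ` J"
      using ev_iff[of "lam n"] assms(5)[OF n] by auto
  qed
  moreover have "?s ` J \<subseteq> (\<lambda>n. sqrt (1 - (lam n)\<^sup>2)) ` I \<union> {1}"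
  proof (intro image_subsetI)
    fix j assume j: "j \<in> J"
    show "?s j \<in> (\<lambda>n. sqrt (1 - (lam n)\<^sup>2)) ` I \<union> {1}"
    proof (cases "?s j = 1")
      case False
      then have s: "0 < ?s j" "?s j < 1"
        using J_singular_value[OF j] by auto
      \<comment> \<open>The positive solution of \<open>sqrt (1 - l\<^sup>2) = ?s j\<close>. As it
        lies strictly between 0 and 1, the exceptional eigenvalues 1 and -1 are ruled out below, and
        the sign relating it to \<open>lam n\<close> disappears on squaring.\<close>
      define l where "l = sqrt (1 - (?s j)\<^sup>2)"
      have s2: "(?s j)\<^sup>2 < 1" "0 < (?s j)\<^sup>2" using s by (auto simp: power_less_one_iff)
      then have l: "0 < l" "l < 1" "sqrt (1 - l\<^sup>2) = ?s j"
        using s by (auto simp: l_def)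
      then have "eigenvalue A (complex_of_real l)"
        using ev_iff[of l] j by auto
      then have "complex_of_real l
          \<in> (\<Union>n\<in>I. {complex_of_real (lam n), - complex_of_real (lam n)}) \<union> {1, - 1}"
        using assms(7) l(1) by auto
      then obtain n where "n \<in> I" "l = lam n \<or> l = - lam n"
        using l by (auto simp: complex_eq_iff)
      then show ?thesis using l(3) by (auto intro!: image_eqI[of _ _ n])
    qed simp
  qed
  moreover have "\<forall>n\<in>I. \<exists>B. orthonormal_basis B (eigenspace A (complex_of_real (lam n))) \<and>
      B \<approx> {j \<in> J. ?s j = sqrt (1 - (lam n)\<^sup>2)}"
    using basis assms(5) by force
  ultimately show ?thesis using dec by blast
qed

end
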